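(* Let $E\subset\mathbf{R}^2$ be a nondegenerate triangle with barycentric coordinates $\lambda_1^E,\lambda_2^E,\lambda_3^E$. Let $I_1,I_2,I_3$ be finite sets of integers and let $f_\ell^E:[0,1]\to\mathbf{R}$, $\ell\in I_1\cup I_2\cup I_3$, be integrable functions. Assume that these functions are strictly positive almost everywhere on $[0,1]$ and that, for each $k=1,2,3$, there exist two indices $r_k,z_k\in I_k$ such that $$f_{r_k}^E(0)=f_{z_k}^E(1)=0.$$ Then, for any choice of the parameters $\mu\ge 0$ and $\alpha,\beta>-1$, the enrichment functions $$\widetilde{\lambda}_k^E(\mathbf{x})=\omega^E_{\mu,\alpha,\beta}(\mathbf{x})\prod_{\ell\in I_k} f_\ell^E\left(\lambda_k^E(\mathbf{x})\right),\qquad k=1,2,3,$$ are admissible.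
   Context: Notation. $E$ is a (closed) triangle with vertices $\mathbf{v}_1^E,\mathbf{v}_2^E,\mathbf{v}_3^E$; $\mathbf{e}_j^E$ is the edge opposite to $\mathbf{v}_j^E$ and $|\mathbf{e}_j^E|$ its length. The barycentric coordinates $\lambda_i^E$ are the affine functions with $\lambda_i^E(\mathbf{v}_j^E)=\delta_{ij}$. Indices are cyclic modulo 3: $\mathbf{v}_4^E=\mathbf{v}_1^E$, $\mathbf{v}_5^E=\mathbf{v}_2^E$, $\lambda_4^E=\lambda_1^E$, $\lambda_5^E=\lambda_2^E$. Weight function. For $\mu\ge 0$, $\alpha,\beta>-1$, $$\omega^E_{\mu,\alpha,\beta}(\mathbf{x})=\sum_{j=1}^{3}\left(1-\lambda_j^E(\mathbf{x})\right)^{\mu}\left(\lambda_{j+1}^E(\mathbf{x})\right)^{\alpha}\left(\lambda_{j+2}^E(\mathbf{x})\right)^{\beta}.$$ Its restriction to each edge is taken to be the Jacobi weight: $\omega^E_{\mu,\alpha,\beta}(t\mathbf{v}_{j+1}^E+(1-t)\mathbf{v}_{j+2}^E)=t^{\alpha}(1-t)^{\beta}$ for $t\in(0,1)$, $j=1,2,3$ (for $\alpha,\beta>0$ this follows from the formula; otherwise it is the convention used to evaluate the weight on the edges). At a vertex, the product of the weight with factors one of which is zero is understood to be $0$. Linear functionals. $\mathcal{L}_i(v)=v(\mathbf{v}_i^E)$ and $\widetilde{\mathcal{L}}_j(v)=\frac{1}{|\mathbf{e}_j^E|}\int_{\mathbf{e}_j^E}v\,d\mathbf{x}$ (arc-length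 integral), $i,j=1,2,3$. Functions are considered pointwise on $E$. Standing assumption: all these functionals are well defined (in particular the edge integrals are finite) on the linear span of $\lambda_1^E,\lambda_2^E,\lambda_3^E$ and the enrichment functions $\widetilde{\lambda}_1^E,\widetilde{\lambda}_2^E,\widetilde{\lambda}_3^E$. Admissibility. Let $P^1(E)$ be the polynomials of degree at most one on $E$. Three functions $\widetilde{\lambda}_1^E,\widetilde{\lambda}_2^E,\widetilde{\lambda}_3^E$ on $E$ are called admissible if they are linearly independent, $P^1(E)\cap\operatorname{span}\{\widetilde{\lambda}_1^E,\widetilde{\lambda}_2^E,\widetilde{\lambda}_3^E\}=\{0\}$, and the 6-dimensional space $V_h(E)=P^1(E)\oplus\operatorname{span}\{\widetilde{\lambda}_1^E,\widetilde{\lambda}_2^E,\widetilde{\lambda}_3^E\}$ has a basis $\varphi_1^E,\dots,\varphi_6^E$ such that, for all $i,j,r,s\in\{1,2,3\}$, $\mathcal{L}_r(\varphi_i^E)=\delta_{ir}$, $\widetilde{\mathcal{L}}_s(\varphi_i^E)=0$, $\mathcal{L}_r(\varphi_{j+3}^E)=0$, $\widetilde{\mathcal{L}}_s(\varphi_{j+3}^E)=\delta_{js}$. *)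

theory Defs
  imports "HOL-Analysis.Analysis" "HOL-Library.Function_Algebras"
begin

(* The three vertices, edges, etc. are indexed by the numeral type 3, whose arithmetic
   is arithmetic modulo 3; hence j + 1 and j + 2 are the cyclic successors. *)

type_synonym point = "real ^ 2"

global_interpretation fun_space: vector_space "\<lambda>(c::real) (g :: 'a \<Rightarrow> real) x. c * g x"
  by unfold_locales (auto simp: fun_eq_iff algebra_simps)

(* Real functions on a set E are represented by their extension by zero, so that
   equality of representatives is pointwise equality on E. *)
definition on_set :: "'a set \<Rightarrow> ('a \<Rightarrow> real) \<Rightarrow> 'a \<Rightarrow> real" where
  "on_set E g = (\<lambda>x. if x \<in> E then g x else 0)"

definition lin_indep_family :: "('i \<Rightarrow> 'a \<Rightarrow> real) \<Rightarrow> bool" where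
  "lin_indep_family g \<longleftrightarrow> inj g \<and> \<not> fun_space.dependent (range g)"

definition triangle_of :: "(3 \<Rightarrow> point) \<Rightarrow> point set" where
  "triangle_of v = convex hull (range v)"

definition nondegenerate :: "(3 \<Rightarrow> point) \<Rightarrow> bool" where
  "nondegenerate v \<longleftrightarrow> \<not> collinear (range v)"

definition affine_function :: "(point \<Rightarrow> real) \<Rightarrow> bool" where
  "affine_function p \<longleftrightarrow> (\<exists>a b. \<forall>x. p x = a \<bullet> x + b)"

definition P1 :: "point set \<Rightarrow> (point \<Rightarrow> real) set" where
  "P1 E = {on_set E p | p. affine_function p}"

definition barycentric :: "(3 \<Rightarrow> point) \<Rightarrow> (3 \<Rightarrow> point \<Rightarrow> real) \<Rightarrow> bool" where
  "barycentric v lam \<longleftrightarrow>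
     (\<forall>i. affine_function (lam i)) \<and>
     (\<forall>i j. lam i (v j) = (if i = j then 1 else 0))"

definition edge_point :: "(3 \<Rightarrow> point) \<Rightarrow> 3 \<Rightarrow> real \<Rightarrow> point" where
  "edge_point v j t = t *\<^sub>R v (j + 1) + (1 - t) *\<^sub>R v (j + 2)"

definition edge_length :: "(3 \<Rightarrow> point) \<Rightarrow> 3 \<Rightarrow> real" where
  "edge_length v j = dist (v (j + 1)) (v (j + 2))"

(* The parametrisation of the edge by [0,1] has constant speed, the length of the edge. *)
definition edge_integral :: "(3 \<Rightarrow> point) \<Rightarrow> 3 \<Rightarrow> (point \<Rightarrow> real) \<Rightarrow> real" where
  "edge_integral v j g = (LINT t:{0..1}|lebesgue. g (edge_point v j t) * edge_length v j)"

definition edge_integrable :: "(3 \<Rightarrow> point) \<Rightarrow> 3 \<Rightarrow> (point \<Rightarrow> real) \<Rightarrow> bool" where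
  "edge_integrable v j g \<longleftrightarrow>
     (\<lambda>t. g (edge_point v j t) * edge_length v j) absolutely_integrable_on {0..1}"

definition vertex_functional :: "(3 \<Rightarrow> point) \<Rightarrow> 3 \<Rightarrow> (point \<Rightarrow> real) \<Rightarrow> real" where
  "vertex_functional v i g = g (v i)"

definition edge_functional :: "(3 \<Rightarrow> point) \<Rightarrow> 3 \<Rightarrow> (point \<Rightarrow> real) \<Rightarrow> real" where
  "edge_functional v j g = 1 / edge_length v j * edge_integral v j g"

definition functionals_well_defined :: "(3 \<Rightarrow> point) \<Rightarrow> (point \<Rightarrow> real) set \<Rightarrow> bool" where
  "functionals_well_defined v V \<longleftrightarrow> (\<forall>g\<in>V. \<forall>j. edge_integrable v j g)"

(* Since 0 powr a = 0 for every a, including a \<le> 0, this formula takes the value of the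
   Jacobi weight on the open edges for all exponents (see weight_edge), and the value 0
   at the vertices (see weight_vertex). *)
definition weight ::
    "(3 \<Rightarrow> point \<Rightarrow> real) \<Rightarrow> real \<Rightarrow> real \<Rightarrow> real \<Rightarrow> point \<Rightarrow> real" where
  "weight lam \<mu> \<alpha> \<beta> x =
     (\<Sum>j\<in>UNIV. (1 - lam j x) powr \<mu> * lam (j + 1) x powr \<alpha> * lam (j + 2) x powr \<beta>)"

definition enrichment ::
    "(3 \<Rightarrow> point \<Rightarrow> real) \<Rightarrow> real \<Rightarrow> real \<Rightarrow> real \<Rightarrow> (3 \<Rightarrow> int set) \<Rightarrow> (int \<Rightarrow> real \<Rightarrow> real)
     \<Rightarrow> 3 \<Rightarrow> point \<Rightarrow> real" where
  "enrichment lam \<mu> \<alpha> \<beta> I f k x = weight lam \<mu> \<alpha> \<beta> x * (\<Prod>l\<in>I k. f l (lam k x))"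

definition enriched_space :: "(3 \<Rightarrow> point) \<Rightarrow> (3 \<Rightarrow> point \<Rightarrow> real) \<Rightarrow> (point \<Rightarrow> real) set" where
  "enriched_space v g =
     {p + q | p q. p \<in> P1 (triangle_of v) \<and>
        q \<in> fun_space.span (range (\<lambda>k. on_set (triangle_of v) (g k)))}"

(* The basis is indexed by 3 + 3: Inl i stands for the index i, Inr j for the index j + 3. *)
definition admissible :: "(3 \<Rightarrow> point) \<Rightarrow> (3 \<Rightarrow> point \<Rightarrow> real) \<Rightarrow> bool" where
  "admissible v g \<longleftrightarrow>
     lin_indep_family (\<lambda>k. on_set (triangle_of v) (g k)) \<and>
     P1 (triangle_of v) \<inter> fun_space.span (range (\<lambda>k. on_set (triangle_of v) (g k))) = {0} \<and>
     (\<exists>\<phi> :: 3 + 3 \<Rightarrow> point \<Rightarrow> real.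
        lin_indep_family \<phi> \<and> fun_space.span (range \<phi>) = enriched_space v g \<and>
        (\<forall>i r. vertex_functional v r (\<phi> (Inl i)) = (if i = r then 1 else 0)) \<and>
        (\<forall>i s. edge_functional v s (\<phi> (Inl i)) = 0) \<and>
        (\<forall>j r. vertex_functional v r (\<phi> (Inr j)) = 0) \<and>
        (\<forall>j s. edge_functional v s (\<phi> (Inr j)) = (if j = s then 1 else 0)))"

lemma barycentric_edge_point:
  assumes "barycentric v lam"
  shows "lam i (edge_point v j t) = t * lam i (v (j + 1)) + (1 - t) * lam i (v (j + 2))"
proof -
  obtain a b where "\<And>x. lam i x = a \<bullet> x + b"
    using assms unfolding barycentric_def affine_function_def by blast
  then show ?thesis
    by (simp add: edge_point_def inner_add_right algebra_simps)
qed

lemma weight_edge: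
  assumes "barycentric v lam" and "0 < t" and "t < 1"
  shows "weight lam \<mu> \<alpha> \<beta> (edge_point v j t) = t powr \<alpha> * (1 - t) powr \<beta>"
proof -
  have "lam i (v k) = (if i = k then 1 else 0)" for i k
    using assms(1) by (simp add: barycentric_def)
  moreover have "j = 1 \<or> j = 2 \<or> j = 3" by (rule exhaust_3)
  ultimately show ?thesis
    by (auto simp: weight_def barycentric_edge_point[OF assms(1)] sum_3)
qed

lemma weight_vertex:
  assumes "barycentric v lam"
  shows "weight lam \<mu> \<alpha> \<beta> (v j) = 0"
proof -
  have "lam i (v k) = (if i = k then 1 else 0)" for i k
    using assms by (simp add: barycentric_def)
  moreover have "j = 1 \<or> j = 2 \<or> j = 3" by (rule exhaust_3)
  ultimately show ?thesis
    by (auto simp: weight_def sum_3)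
qed

end

theory Submission imports Defs begin

text \<open>The vertex evaluations and edge means are six linear functionals on the span of the three
  barycentric coordinates and the three enrichments. Everything follows from their being unisolvent
  on these six functions, that is, from the invertibility of the matrix of values
  (\<open>unisolvent_dual_basis\<close>).

  The weight vanishes at the vertices, so that matrix is block triangular: the vertex values of the
  barycentric coordinates form the identity and those of the enrichments are zero. What remains is
  the matrix of edge means of the enrichments. Opposite to vertex \<open>k\<close> the coordinate \<open>\<lambda>\<^sub>k\<close> is
  zero, so a factor of the \<open>k\<close>-th enrichment that vanishes at 0 makes its mean there zero
  (\<open>enrichment_own_edge\<close>). On each of the other two edges the enrichment is a Jacobi weight times
  functions that are positive almost everywhere, so its mean is positive
  (\<open>enrichment_other_edge_pos\<close>). A matrix of size three with zero diagonal and positive entries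
  elsewhere is invertible (\<open>hollow_positive_matrix_ker\<close>).

  The sum of the affine functions and the enrichments is direct because a function in both spaces
  vanishes at the vertices, and an affine function is determined on the triangle by its vertex
  values (\<open>affine_function_barycentric\<close>).\<close>

section \<open>Unisolvent functionals and dual bases\<close>

text \<open>Linearity is required on a subspace only, since an integral is not additive on functions that
  are not integrable.\<close>

definition linear_functional_on ::
    "('a \<Rightarrow> real) set \<Rightarrow> (('a \<Rightarrow> real) \<Rightarrow> real) \<Rightarrow> bool" where
  "linear_functional_on V F \<longleftrightarrow>
     (\<forall>g\<in>V. \<forall>h\<in>V. F (g + h) = F g + F h) \<and> (\<forall>c. \<forall>g\<in>V. F (\<lambda>x. c * g x) = c * F g)"

text \<open>The columns of the matrix of values \<open>F i (b j)\<close> are linearly independent. As there are as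
  many functionals as functions, the matrix is then invertible.\<close>

definition unisolvent ::
    "('n::finite \<Rightarrow> ('a \<Rightarrow> real) \<Rightarrow> real) \<Rightarrow> ('n \<Rightarrow> 'a \<Rightarrow> real) \<Rightarrow> bool" where
  "unisolvent F b \<longleftrightarrow> (\<forall>c. (\<forall>i. (\<Sum>j\<in>UNIV. c j * F i (b j)) = 0) \<longrightarrow> (\<forall>j. c j = 0))"

lemma sum_fun_apply: "(\<Sum>i\<in>A. h i) x = (\<Sum>i\<in>A. h i x)" for h :: "'i \<Rightarrow> 'a \<Rightarrow> real"
  by (induction A rule: infinite_finite_induct) auto

lemma linear_functional_on_sum:
  assumes V: "fun_space.subspace V" and F: "linear_functional_on V F"
    and b: "\<And>j. j \<in> A \<Longrightarrow> b j \<in> V"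
  shows "F (\<Sum>j\<in>A. (\<lambda>x. c j * b j x)) = (\<Sum>j\<in>A. c j * F (b j))"
proof -
  have zero: "F 0 = 0"
  proof -
    have "F (\<lambda>x. 0 * (0::'a \<Rightarrow> real) x) = 0 * F 0"
      using F fun_space.subspace_0[OF V] unfolding linear_functional_on_def by blast
    then show ?thesis by (simp add: zero_fun_def)
  qed
  show ?thesis
    using b
  proof (induction A rule: infinite_finite_induct)
    case (insert a A)
    have "(\<Sum>j\<in>A. (\<lambda>x. c j * b j x)) \<in> V"
      using insert.prems by (intro fun_space.subspace_sum[OF V] fun_space.subspace_scale[OF V]) auto
    moreover have "(\<lambda>x. c a * b a x) \<in> V"
      using insert.prems by (intro fun_space.subspace_scale[OF V]) auto
    ultimately have "F ((\<lambda>x. c a * b a x) + (\<Sum>j\<in>A. (\<lambda>x. c j * b j x)))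
        = F (\<lambda>x. c a * b a x) + F (\<Sum>j\<in>A. (\<lambda>x. c j * b j x))"
      using F unfolding linear_functional_on_def by blast
    moreover have "F (\<lambda>x. c a * b a x) = c a * F (b a)"
      using F insert.prems unfolding linear_functional_on_def by blast
    ultimately show ?case
      using insert.IH insert.prems by (simp only: sum.insert[OF insert.hyps]) auto
  qed (simp_all add: zero)
qed

text \<open>A linear relation among the functions turns, under the functionals, into a linear relation
  among the columns of the matrix of values. A repeated function counts as such a relation, which
  gives injectivity.\<close>

lemma unisolvent_lin_indep:
  fixes F :: "'n::finite \<Rightarrow> ('a \<Rightarrow> real) \<Rightarrow> real"
  assumes V: "fun_space.subspace V" and F: "\<And>i. linear_functional_on V (F i)"
    and b: "\<And>j. b j \<in> V" and uni: "unisolvent F b"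
  shows "lin_indep_family b"
proof -
  have inj: "inj b"
  proof (rule injI, rule ccontr)
    fix j k assume eq: "b j = b k" and "j \<noteq> k"
    (* coefficients of the relation b j - b k = 0 *)
    define c :: "'n \<Rightarrow> real" where "c i = (if i = j then 1 else 0) - (if i = k then 1 else 0)" for i
    have "(\<Sum>l\<in>UNIV. c l * F i (b l)) = F i (b j) - F i (b k)" for i
      unfolding c_def left_diff_distrib sum_subtractf
      by (simp add: if_distrib[of "\<lambda>a. a * _"] cong: if_cong)
    then have "c j = 0"
      using uni eq unfolding unisolvent_def by simp
    then show False using \<open>j \<noteq> k\<close> by (simp add: c_def)
  qed
  have "\<not> fun_space.dependent (range b)"
  proof
    assume "fun_space.dependent (range b)"
    then obtain u where u: "\<exists>g\<in>range b. u g \<noteq> 0" "(\<Sum>g\<in>range b. (\<lambda>x. u g * g x)) = 0"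
      by (auto simp: fun_space.dependent_finite)
    have "(\<Sum>j\<in>UNIV. u (b j) * F i (b j)) = 0" for i
    proof -
      (* zero is written as an empty sum, so that linearity also gives its value under F i *)
      have "(\<Sum>j\<in>UNIV. (\<lambda>x. u (b j) * b j x)) = (\<Sum>j\<in>{}. (\<lambda>x. u (b j) * b j x))"
        using u(2) by (simp add: sum.reindex[OF inj] comp_def)
      then show ?thesis
        using linear_functional_on_sum[OF V F, of UNIV b i "\<lambda>j. u (b j)"]
          linear_functional_on_sum[OF V F, of "{}" b i "\<lambda>j. u (b j)"] b by simp
    qed
    then have "\<forall>j. u (b j) = 0"
      using uni[unfolded unisolvent_def, rule_format, of "\<lambda>j. u (b j)"] by simp
    then show False using u(1) by blast
  qed
  with inj show ?thesis by (simp add: lin_indep_family_def)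
qed

text \<open>Unisolvence says that the matrix of values is invertible; the columns of its inverse are the
  coefficients of the dual basis.\<close>

lemma unisolvent_dual_basis:
  fixes F :: "'n::finite \<Rightarrow> ('a \<Rightarrow> real) \<Rightarrow> real"
  assumes V: "fun_space.subspace V" and F: "\<And>i. linear_functional_on V (F i)"
    and b: "\<And>j. b j \<in> V" and uni: "unisolvent F b"
  obtains \<phi> where "lin_indep_family \<phi>" "fun_space.span (range \<phi>) = fun_space.span (range b)"
    "\<And>i j. F i (\<phi> j) = (if j = i then 1 else 0)"
proof -
  define A :: "real^'n^'n" where "A = (\<chi> i j. F i (b j))"
  have "\<forall>x. A *v x = 0 \<longrightarrow> x = 0"
  proof (intro allI impI)
    fix x assume "A *v x = 0"
    then have "\<forall>i. (\<Sum>j\<in>UNIV. x $ j * F i (b j)) = 0"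
      by (simp add: A_def matrix_vector_mult_def vec_eq_iff mult.commute)
    then show "x = 0"
      using uni[unfolded unisolvent_def, rule_format, of "\<lambda>j. x $ j"] by (simp add: vec_eq_iff)
  qed
  then obtain B where BA: "B ** A = mat 1"
    using matrix_left_invertible_ker by blast
  then have AB: "A ** B = mat 1"
    by (simp add: matrix_left_right_inverse)
  define \<phi> where "\<phi> k = (\<Sum>j\<in>UNIV. (\<lambda>x. B $ j $ k * b j x))" for k
  have dual: "F i (\<phi> j) = (if j = i then 1 else 0)" for i j
  proof -
    have "F i (\<phi> j) = (\<Sum>k\<in>UNIV. B $ k $ j * F i (b k))"
      unfolding \<phi>_def using b by (intro linear_functional_on_sum[OF V F])
    also have "\<dots> = (A ** B) $ i $ j"
      by (simp add: matrix_matrix_mult_def A_def mult.commute)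
    also have "\<dots> = (if j = i then 1 else 0)"
      by (auto simp: AB mat_def)
    finally show ?thesis .
  qed
  have \<phi>_V: "\<phi> k \<in> V" for k
    unfolding \<phi>_def using b by (intro fun_space.subspace_sum[OF V] fun_space.subspace_scale[OF V])
  have "unisolvent F \<phi>"
    by (simp add: unisolvent_def dual if_distrib cong: if_cong)
  then have indep: "lin_indep_family \<phi>"
    by (intro unisolvent_lin_indep[OF V F \<phi>_V])
  have \<phi>_span: "\<phi> k \<in> fun_space.span (range b)" for k
    unfolding \<phi>_def
    by (intro fun_space.span_sum fun_space.span_scale fun_space.span_base) auto
  have b_span: "b l \<in> fun_space.span (range \<phi>)" for l
  proof -
    (* a function is the combination of the dual basis with its own functional values *)
    have "(\<Sum>k\<in>UNIV. (\<lambda>x. A $ k $ l * \<phi> k x)) = b l"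
    proof
      fix x
      have "(\<Sum>k\<in>UNIV. (\<lambda>x. A $ k $ l * \<phi> k x)) x
          = (\<Sum>k\<in>UNIV. \<Sum>j\<in>UNIV. B $ j $ k * A $ k $ l * b j x)"
        by (simp add: \<phi>_def sum_fun_apply sum_distrib_left mult_ac)
      also have "\<dots> = (\<Sum>j\<in>UNIV. (B ** A) $ j $ l * b j x)"
        by (subst sum.swap) (simp add: matrix_matrix_mult_def sum_distrib_right)
      also have "\<dots> = b l x"
        by (simp add: BA mat_def if_distrib if_distribR cong: if_cong)
      finally show "(\<Sum>k\<in>UNIV. (\<lambda>x. A $ k $ l * \<phi> k x)) x = b l x" .
    qed
    moreover have "(\<Sum>k\<in>UNIV. (\<lambda>x. A $ k $ l * \<phi> k x)) \<in> fun_space.span (range \<phi>)"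
      by (intro fun_space.span_sum fun_space.span_scale fun_space.span_base) auto
    ultimately show ?thesis by simp
  qed
  have "fun_space.span (range \<phi>) = fun_space.span (range b)"
    using \<phi>_span b_span by (subst fun_space.span_eq) auto
  then show thesis
    using that indep dual by blast
qed

section \<open>The matrix of edge functionals\<close>

text \<open>Row \<open>s\<close> says that two of the unknowns, weighted positively, cancel, so they have opposite
  signs or vanish; three numbers cannot have pairwise opposite signs.\<close>

lemma hollow_positive_matrix_ker:
  fixes M :: "3 \<Rightarrow> 3 \<Rightarrow> real" and c :: "3 \<Rightarrow> real"
  assumes "\<And>s. M s s = 0" and pos: "\<And>s k. s \<noteq> k \<Longrightarrow> M s k > 0"
    and ker: "\<And>s. (\<Sum>k\<in>UNIV. c k * M s k) = 0"
  shows "c k = 0"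
proof -
  have opposite: "x * y \<le> 0 \<and> (x = 0 \<longleftrightarrow> y = 0)"
    if "x * a + y * b = 0" "a > 0" "b > 0" for a b x y :: real
  proof -
    have x: "x = - (b / a) * y" using that by (simp add: field_simps)
    have "x * y = - (b / a) * (y * y)" by (simp add: x)
    also have "\<dots> \<le> 0" using that by (intro mult_nonpos_nonneg) auto
    finally show ?thesis using that x by simp
  qed
  have neq: "(1::3) \<noteq> 2" "(1::3) \<noteq> 3" "(2::3) \<noteq> 3" by simp_all
  have c12: "c 1 * c 2 \<le> 0 \<and> (c 1 = 0 \<longleftrightarrow> c 2 = 0)"
    by (rule opposite[of _ "M 3 1" _ "M 3 2"]) (use ker[of 3] assms(1) pos neq in \<open>auto simp: sum_3\<close>)
  have c13: "c 1 * c 3 \<le> 0 \<and> (c 1 = 0 \<longleftrightarrow> c 3 = 0)"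
    by (rule opposite[of _ "M 2 1" _ "M 2 3"]) (use ker[of 2] assms(1) pos neq in \<open>auto simp: sum_3\<close>)
  have c23: "c 2 * c 3 \<le> 0 \<and> (c 2 = 0 \<longleftrightarrow> c 3 = 0)"
    by (rule opposite[of _ "M 1 2" _ "M 1 3"]) (use ker[of 1] assms(1) pos neq in \<open>auto simp: sum_3\<close>)
  have "c 1 = 0"
    using c12 c13 c23 by (smt (verit) mult_less_0_iff mult_pos_pos mult_neg_neg)
  then show ?thesis
    using c12 c13 exhaust_3[of k] by auto
qed

text \<open>The factors of an enrichment are traversed backwards on one of the two edges where it is
  positive; the reflection \<open>t \<mapsto> 1 - t\<close> preserves negligible sets.\<close>

lemma AE_unit_interval_reflect:
  assumes "AE t in lebesgue_on {0..1::real}. P t"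
  shows "AE t in lebesgue_on {0..1::real}. P (1 - t)"
proof -
  have "AE t in lebesgue. t \<in> {0..1} \<longrightarrow> P t"
    using assms by (simp add: AE_restrict_space_iff)
  then have "negligible {t. \<not> (t \<in> {0..1} \<longrightarrow> P t)}"
    by (simp add: negligible_iff_null_sets completion.AE_iff_null_sets)
  then have "negligible ((\<lambda>t. 1 - t) ` {t. \<not> (t \<in> {0..1} \<longrightarrow> P t)})"
    by (rule negligible_differentiable_image_negligible[OF order_refl]) (auto intro!: derivative_intros)
  moreover have "(\<lambda>t. 1 - t) ` {t. \<not> (t \<in> {0..1} \<longrightarrow> P t)} = {t. \<not> (t \<in> {0..1} \<longrightarrow> P (1 - t))}"
    (is "?L = ?R")
  proof
    show "?R \<subseteq> ?L"
    proof
      fix t assume "t \<in> ?R"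
      then show "t \<in> ?L"
        by (intro image_eqI[of _ _ "1 - t"]) auto
    qed
  qed auto
  ultimately have "{t. \<not> (t \<in> {0..1} \<longrightarrow> P (1 - t))} \<in> null_sets lebesgue"
    by (simp add: negligible_iff_null_sets)
  then have "AE t in lebesgue. t \<in> {0..1} \<longrightarrow> P (1 - t)"
    by (rule AE_I') auto
  then show ?thesis by (simp add: AE_restrict_space_iff)
qed

lemma unit_interval_integral_pos:
  fixes h :: "real \<Rightarrow> real"
  assumes int: "h absolutely_integrable_on {0..1}"
    and pos: "AE t in lebesgue_on {0..1}. h t > 0"
  shows "(LINT t:{0..1}|lebesgue. h t) > 0"
proof -
  let ?h = "\<lambda>t. indicator {0..1} t *\<^sub>R h t"
  have pos': "AE t in lebesgue. t \<in> {0..1} \<longrightarrow> h t > 0"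
    using pos by (simp add: AE_restrict_space_iff)
  have int': "integrable lebesgue ?h"
    using int by (simp add: set_integrable_def)
  have nonneg: "AE t in lebesgue. 0 \<le> ?h t"
    using pos' by eventually_elim (auto simp: indicator_def)
  have "integral\<^sup>L lebesgue ?h \<noteq> 0"
  proof
    assume "integral\<^sup>L lebesgue ?h = 0"
    then have "AE t in lebesgue. ?h t = 0"
      using integral_nonneg_eq_0_iff_AE[OF int' nonneg] by simp
    with pos' have "AE t in lebesgue. t \<notin> {0..1::real}"
      by eventually_elim (auto simp: indicator_def)
    then have "{0..1::real} \<in> null_sets lebesgue"
      by (subst (asm) AE_iff_null_sets[symmetric]) auto
    then have "emeasure lebesgue {0..1::real} = 0"
      by (rule null_setsD1)
    then show False by simp
  qed
  moreover have "integral\<^sup>L lebesgue ?h \<ge> 0"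
    by (rule integral_nonneg_AE[OF nonneg])
  ultimately show ?thesis by (simp add: set_lebesgue_integral_def)
qed

lemma edge_point_in_triangle:
  assumes "t \<in> {0..1}"
  shows "edge_point v j t \<in> triangle_of v"
  unfolding edge_point_def triangle_of_def
  using assms by (intro convexD[OF convex_convex_hull] hull_inc) auto

lemma vertex_in_triangle: "v i \<in> triangle_of v"
  unfolding triangle_of_def by (rule hull_inc) simp

lemma edge_length_pos:
  assumes "barycentric v lam"
  shows "edge_length v j > 0"
proof -
  have "lam (j + 1) (v (j + 1)) \<noteq> lam (j + 1) (v (j + 2))"
    using assms exhaust_3[of j] by (auto simp: barycentric_def)
  then have "v (j + 1) \<noteq> v (j + 2)" by metis
  then show ?thesis by (simp add: edge_length_def)
qed

lemma edge_functional_on_set: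
  "edge_functional v j (on_set (triangle_of v) g) = edge_functional v j g"
proof -
  have "(LINT t:{0..1}|lebesgue. on_set (triangle_of v) g (edge_point v j t) * edge_length v j)
      = (LINT t:{0..1}|lebesgue. g (edge_point v j t) * edge_length v j)"
    by (rule set_lebesgue_integral_cong) (auto simp: on_set_def edge_point_in_triangle)
  then show ?thesis unfolding edge_functional_def edge_integral_def by (rule arg_cong)
qed

lemma edge_integrable_on_set:
  "edge_integrable v j (on_set (triangle_of v) g) \<longleftrightarrow> edge_integrable v j g"
  unfolding edge_integrable_def
  by (rule set_integrable_cong) (auto simp: on_set_def edge_point_in_triangle)

lemma edge_functional_pos:
  assumes bary: "barycentric v lam" and int: "edge_integrable v j g"
    and pos: "AE t in lebesgue_on {0..1}. g (edge_point v j t) > 0"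
  shows "edge_functional v j g > 0"
proof -
  note len = edge_length_pos[OF bary, of j]
  have "edge_integral v j g > 0"
    unfolding edge_integral_def
    by (rule unit_interval_integral_pos)
      (use int pos len in \<open>auto simp: edge_integrable_def elim!: eventually_mono\<close>)
  with len show ?thesis by (simp add: edge_functional_def)
qed

lemma linear_functional_on_edge:
  assumes "functionals_well_defined v V"
  shows "linear_functional_on V (edge_functional v j)"
proof -
  have int: "edge_integrable v j g" if "g \<in> V" for g
    using assms that by (simp add: functionals_well_defined_def)
  have "edge_functional v j (g + h) = edge_functional v j g + edge_functional v j h"
    if "g \<in> V" "h \<in> V" for g h
    using int[OF that(1)] int[OF that(2)]
    by (simp add: edge_integrable_def edge_functional_def edge_integral_def distrib_right
        distrib_left add_divide_distrib set_integral_add)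
  moreover have "edge_functional v j (\<lambda>x. c * g x) = c * edge_functional v j g" for c g
    by (simp add: edge_functional_def edge_integral_def mult.assoc)
  ultimately show ?thesis by (simp add: linear_functional_on_def)
qed

lemma linear_functional_on_vertex: "linear_functional_on V (vertex_functional v i)"
  by (simp add: linear_functional_on_def vertex_functional_def)

section \<open>Affine functions and enrichments on the triangle\<close>

text \<open>The set where two affine functions agree is convex, so on the convex hull an affine function
  is determined by its values at the vertices.\<close>

lemma affine_function_barycentric:
  assumes bary: "barycentric v lam" and p: "affine_function p" and x: "x \<in> triangle_of v"
  shows "p x = (\<Sum>i\<in>UNIV. p (v i) * lam i x)"
proof -
  obtain a b where p_eq: "\<And>x. p x = a \<bullet> x + b"
    using p by (auto simp: affine_function_def)
  obtain A B where lam_eq: "\<And>i x. lam i x = A i \<bullet> x + B i"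
    using bary unfolding barycentric_def affine_function_def by metis
  (* the difference of the two sides is the affine function with normal n and offset d *)
  define n where "n = (\<Sum>i\<in>UNIV. p (v i) *\<^sub>R A i) - a"
  define d where "d = b - (\<Sum>i\<in>UNIV. p (v i) * B i)"
  have diff: "(\<Sum>i\<in>UNIV. p (v i) * lam i x) - p x = n \<bullet> x - d" for x
    by (simp add: n_def d_def lam_eq p_eq[of x] inner_diff_left inner_sum_left distrib_left
        sum.distrib)
  have "range v \<subseteq> {x. n \<bullet> x = d}"
  proof safe
    fix j
    have "(\<Sum>i\<in>UNIV. p (v i) * lam i (v j)) = p (v j)"
      using bary by (simp add: barycentric_def if_distrib[of "\<lambda>a. _ * a"] cong: if_cong)
    with diff[of "v j"] show "n \<bullet> v j = d" by simp
  qed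
  then have "triangle_of v \<subseteq> {x. n \<bullet> x = d}"
    unfolding triangle_of_def by (intro hull_minimal convex_hyperplane)
  with x diff[of x] show ?thesis by auto
qed

text \<open>This places the affine functions and the enrichments on the same footing, as spans of finite
  families, so that the enriched space is the span of the six functions together.\<close>

lemma P1_eq_span:
  assumes bary: "barycentric v lam"
  shows "P1 (triangle_of v) = fun_space.span (range (\<lambda>i. on_set (triangle_of v) (lam i)))"
    (is "_ = fun_space.span ?B")
proof
  show "P1 (triangle_of v) \<subseteq> fun_space.span ?B"
  proof
    fix g assume "g \<in> P1 (triangle_of v)"
    then obtain p where p: "affine_function p" and g: "g = on_set (triangle_of v) p"
      by (auto simp: P1_def)
    have "g = (\<Sum>i\<in>UNIV. (\<lambda>x. p (v i) * on_set (triangle_of v) (lam i) x))"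
      using affine_function_barycentric[OF bary p]
      by (auto simp: g on_set_def fun_eq_iff sum_fun_apply)
    also have "\<dots> \<in> fun_space.span ?B"
      by (intro fun_space.span_sum fun_space.span_scale fun_space.span_base) auto
    finally show "g \<in> fun_space.span ?B" .
  qed
  have "fun_space.subspace (P1 (triangle_of v))"
  proof (rule fun_space.subspaceI)
    show "0 \<in> P1 (triangle_of v)"
      unfolding P1_def affine_function_def
      by (intro CollectI exI[of _ "\<lambda>x. 0 \<bullet> x + 0"] conjI exI[of _ 0])
        (auto simp: on_set_def fun_eq_iff)
  next
    fix g h assume "g \<in> P1 (triangle_of v)" "h \<in> P1 (triangle_of v)"
    then obtain a b a' b' where
      "g = on_set (triangle_of v) (\<lambda>x. a \<bullet> x + b)" "h = on_set (triangle_of v) (\<lambda>x. a' \<bullet> x + b')"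
      unfolding P1_def affine_function_def by (auto simp: fun_eq_iff[symmetric])
    then have "g + h = on_set (triangle_of v) (\<lambda>x. (a + a') \<bullet> x + (b + b'))"
      by (auto simp: on_set_def fun_eq_iff inner_add_left)
    then show "g + h \<in> P1 (triangle_of v)"
      unfolding P1_def affine_function_def by blast
  next
    fix c g assume "g \<in> P1 (triangle_of v)"
    then obtain a b where "g = on_set (triangle_of v) (\<lambda>x. a \<bullet> x + b)"
      unfolding P1_def affine_function_def by (auto simp: fun_eq_iff[symmetric])
    then have "(\<lambda>x. c * g x) = on_set (triangle_of v) (\<lambda>x. (c *\<^sub>R a) \<bullet> x + c * b)"
      by (auto simp: on_set_def fun_eq_iff distrib_left)
    then show "(\<lambda>x. c * g x) \<in> P1 (triangle_of v)"
      unfolding P1_def affine_function_def by blast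
  qed
  moreover have "?B \<subseteq> P1 (triangle_of v)"
    using bary by (auto simp: P1_def barycentric_def)
  ultimately show "fun_space.span ?B \<subseteq> P1 (triangle_of v)"
    by (intro fun_space.span_minimal)
qed

lemma enrichment_vertex:
  assumes "barycentric v lam"
  shows "enrichment lam \<mu> \<alpha> \<beta> I f k (v i) = 0"
  by (simp add: enrichment_def weight_vertex[OF assms])

lemma enrichment_own_edge:
  assumes bary: "barycentric v lam" and "finite (I k)" "r \<in> I k" "f r 0 = 0"
  shows "enrichment lam \<mu> \<alpha> \<beta> I f k (edge_point v k t) = 0"
proof -
  have "lam k (v (k + 1)) = 0" "lam k (v (k + 2)) = 0"
    using bary exhaust_3[of k] by (auto simp: barycentric_def)
  then have "lam k (edge_point v k t) = 0"
    by (simp add: barycentric_edge_point[OF bary])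
  then show ?thesis using assms by (auto simp: enrichment_def)
qed

text \<open>On an edge not opposite to vertex \<open>k\<close>, the coordinate \<open>\<lambda>\<^sub>k\<close> runs over the unit
  interval in one of the two directions.\<close>

lemma enrichment_other_edge_pos:
  assumes bary: "barycentric v lam" and fin: "finite (I k)"
    and pos: "\<And>l. l \<in> I k \<Longrightarrow> AE t in lebesgue_on {0..1}. f l t > 0" and "s \<noteq> k"
  shows "AE t in lebesgue_on {0..1}. enrichment lam \<mu> \<alpha> \<beta> I f k (edge_point v s t) > 0"
proof -
  have lam_vertex: "lam i (v j) = (if i = j then 1 else 0)" for i j
    using bary by (simp add: barycentric_def)
  have coordinate: "(\<forall>t. lam k (edge_point v s t) = t) \<or> (\<forall>t. lam k (edge_point v s t) = 1 - t)"
    using \<open>s \<noteq> k\<close> exhaust_3[of s] exhaust_3[of k]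
    by (auto simp: barycentric_edge_point[OF bary] lam_vertex)
  have "AE t in lebesgue_on {0..1}. f l (lam k (edge_point v s t)) > 0" if "l \<in> I k" for l
    using coordinate pos[OF that] AE_unit_interval_reflect[OF pos[OF that]] by auto
  then have factors: "AE t in lebesgue_on {0..1}. \<forall>l\<in>I k. f l (lam k (edge_point v s t)) > 0"
    using fin by (intro AE_finite_allI)
  (* at the endpoints of the edge the weight is zero *)
  have "{0, 1::real} \<in> null_sets lebesgue"
    by (simp add: negligible_iff_null_sets[symmetric])
  then have "AE t in lebesgue. t \<notin> {0, 1::real}" by (rule AE_not_in)
  then have "AE t in lebesgue. t \<in> {0..1} \<longrightarrow> t \<in> {0<..<1::real}"
    by (rule eventually_mono) auto
  then have interior: "AE t in lebesgue_on {0..1}. t \<in> {0<..<1::real}"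
    by (simp add: AE_restrict_space_iff del: greaterThanLessThan_iff)
  from factors interior show ?thesis
    by eventually_elim (simp add: enrichment_def weight_edge[OF bary] prod_pos)
qed

theorem theorem4p9:
  fixes v :: "3 \<Rightarrow> real ^ 2"
    and lam :: "3 \<Rightarrow> real ^ 2 \<Rightarrow> real"
    and I :: "3 \<Rightarrow> int set"
    and f :: "int \<Rightarrow> real \<Rightarrow> real"
    and \<mu> \<alpha> \<beta> :: real
  assumes "nondegenerate v"
    and "barycentric v lam"
    and "\<And>k. finite (I k)"
    and "\<And>l. l \<in> (\<Union>k. I k) \<Longrightarrow> f l absolutely_integrable_on {0..1}"
    and "\<And>l. l \<in> (\<Union>k. I k) \<Longrightarrow> AE t in lebesgue_on {0..1}. f l t > 0"
    and "\<And>k. \<exists>r\<in>I k. \<exists>z\<in>I k. f r 0 = 0 \<and> f z 1 = 0"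
    and "\<mu> \<ge> 0" and "\<alpha> > -1" and "\<beta> > -1"
    and "functionals_well_defined v (fun_space.span
           (on_set (triangle_of v) ` (range lam \<union> range (enrichment lam \<mu> \<alpha> \<beta> I f))))"
  shows "admissible v (enrichment lam \<mu> \<alpha> \<beta> I f)"
proof -
  note bary = assms(2)
  define g where "g = enrichment lam \<mu> \<alpha> \<beta> I f"
  define lamT where "lamT i = on_set (triangle_of v) (lam i)" for i
  define gT where "gT k = on_set (triangle_of v) (g k)" for k
  define V where "V = fun_space.span (range lamT \<union> range gT)"
  have V: "fun_space.subspace V"
    unfolding V_def by (rule fun_space.subspace_span)
  have "on_set (triangle_of v) ` (range lam \<union> range g) = range lamT \<union> range gT"
    by (auto simp: lamT_def gT_def)
  then have wd: "functionals_well_defined v V"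
    using assms(10) by (simp add: V_def g_def)
  have lamT_V: "lamT i \<in> V" and gT_V: "gT i \<in> V" for i
    unfolding V_def by (auto intro: fun_space.span_base)

  have lamT_vertex: "vertex_functional v r (lamT i) = (if i = r then 1 else 0)" for i r
    using bary by (simp add: lamT_def on_set_def vertex_in_triangle vertex_functional_def
        barycentric_def)
  have gT_vertex: "vertex_functional v r (gT i) = 0" for i r
    by (simp add: gT_def on_set_def g_def vertex_functional_def enrichment_vertex[OF bary])
  have edge_zero: "edge_functional v s (gT s) = 0" for s
  proof -
    obtain r where "r \<in> I s" "f r 0 = 0" using assms(6) by blast
    then show ?thesis
      unfolding gT_def edge_functional_on_set
      by (simp add: g_def edge_functional_def edge_integral_def
          enrichment_own_edge[OF bary assms(3)])
  qed
  have edge_pos: "edge_functional v s (gT k) > 0" if "s \<noteq> k" for s k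
  proof -
    have "edge_integrable v s (gT k)"
      using wd gT_V by (simp add: functionals_well_defined_def)
    then show ?thesis
      unfolding gT_def edge_functional_on_set edge_integrable_on_set g_def
      using assms(5) that
      by (intro edge_functional_pos[OF bary] enrichment_other_edge_pos[OF bary assms(3)]) auto
  qed
  have edge_uni: "unisolvent (edge_functional v) gT"
    unfolding unisolvent_def
    using hollow_positive_matrix_ker[of "\<lambda>s k. edge_functional v s (gT k)"] edge_zero edge_pos
    by blast

  define F where "F = case_sum (vertex_functional v) (edge_functional v)"
  define b where "b = case_sum lamT gT"
  have F: "linear_functional_on V (F i)" for i
    by (cases i) (simp_all add: F_def linear_functional_on_vertex linear_functional_on_edge[OF wd])
  have b_V: "b j \<in> V" for j
    by (cases j) (simp_all add: b_def lamT_V gT_V)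
  have sum_split: "(\<Sum>j\<in>UNIV. h j) = (\<Sum>i\<in>UNIV. h (Inl i)) + (\<Sum>k\<in>UNIV. h (Inr k))"
    for h :: "3 + 3 \<Rightarrow> real"
    by (simp add: UNIV_Plus_UNIV[symmetric] sum.Plus del: UNIV_Plus_UNIV)
  have uni: "unisolvent F b"
    unfolding unisolvent_def
  proof (intro allI impI)
    fix c :: "3 + 3 \<Rightarrow> real" and j
    assume ker: "\<forall>i. (\<Sum>j\<in>UNIV. c j * F i (b j)) = 0"
    (* the vertex rows see the barycentric coordinates only *)
    have cl: "c (Inl r) = 0" for r
      using ker[rule_format, of "Inl r"]
      by (simp add: sum_split F_def b_def lamT_vertex gT_vertex if_distrib cong: if_cong)
    have "(\<Sum>k\<in>UNIV. c (Inr k) * edge_functional v s (gT k)) = 0" for s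
      using ker[rule_format, of "Inr s"] by (simp add: sum_split F_def b_def cl)
    then have "c (Inr k) = 0" for k
      using edge_uni[unfolded unisolvent_def, rule_format, of "\<lambda>k. c (Inr k)"] by blast
    with cl show "c j = 0" by (cases j) auto
  qed
  obtain \<phi> where \<phi>: "lin_indep_family \<phi>"
      "fun_space.span (range \<phi>) = fun_space.span (range b)"
      "\<And>i j. F i (\<phi> j) = (if j = i then 1 else 0)"
    using unisolvent_dual_basis[OF V F b_V uni] by blast

  have P1: "P1 (triangle_of v) = fun_space.span (range lamT)"
    unfolding lamT_def by (rule P1_eq_span[OF bary])
  have "range b = range lamT \<union> range gT"
    by (simp add: b_def UNIV_Plus_UNIV[symmetric] Plus_def image_Un image_image
        del: UNIV_Plus_UNIV)
  then have space: "fun_space.span (range b) = enriched_space v g"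
    unfolding enriched_space_def P1 gT_def[symmetric] by (simp add: fun_space.span_Un)

  have "P1 (triangle_of v) \<inter> fun_space.span (range gT) = {0}"
  proof
    show "P1 (triangle_of v) \<inter> fun_space.span (range gT) \<subseteq> {0}"
    proof safe
      fix q assume "q \<in> P1 (triangle_of v)" and q: "q \<in> fun_space.span (range gT)"
      then obtain p where p: "affine_function p" "q = on_set (triangle_of v) p"
        by (auto simp: P1_def)
      have "fun_space.subspace {h. \<forall>i. h (v i) = 0}"
        by (rule fun_space.subspaceI) auto
      moreover have "range gT \<subseteq> {h. \<forall>i. h (v i) = 0}"
        using gT_vertex by (auto simp: vertex_functional_def)
      ultimately have "\<forall>i. q (v i) = 0"
        using fun_space.span_minimal q by blast
      then have "p (v i) = 0" for i
        by (simp add: p(2) on_set_def vertex_in_triangle)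
      then show "q = 0"
        using affine_function_barycentric[OF bary p(1)] by (auto simp: p(2) on_set_def fun_eq_iff)
    qed
    show "{0} \<subseteq> P1 (triangle_of v) \<inter> fun_space.span (range gT)"
      unfolding P1 by (auto intro: fun_space.span_zero)
  qed
  moreover have "lin_indep_family gT"
    using unisolvent_lin_indep[OF V linear_functional_on_edge[OF wd] gT_V edge_uni] .
  moreover have "\<exists>\<phi> :: 3 + 3 \<Rightarrow> point \<Rightarrow> real.
        lin_indep_family \<phi> \<and> fun_space.span (range \<phi>) = enriched_space v g \<and>
        (\<forall>i r. vertex_functional v r (\<phi> (Inl i)) = (if i = r then 1 else 0)) \<and>
        (\<forall>i s. edge_functional v s (\<phi> (Inl i)) = 0) \<and>
        (\<forall>j r. vertex_functional v r (\<phi> (Inr j)) = 0) \<and>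
        (\<forall>j s. edge_functional v s (\<phi> (Inr j)) = (if j = s then 1 else 0))"
    using \<phi>(1,2) \<phi>(3)[of "Inl _" "Inl _"] \<phi>(3)[of "Inl _" "Inr _"]
      \<phi>(3)[of "Inr _" "Inl _"] \<phi>(3)[of "Inr _" "Inr _"]
    by (intro exI[of _ \<phi>]) (simp add: space F_def)
  ultimately show ?thesis
    unfolding admissible_def gT_def g_def by blast
qed

end
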